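(* Let $a,b,d\in\mathbb{C}_p$ with $a\neq 0$ and ($b\neq -2a^2$ or $d\neq -2a$), and let $$f(x)=\frac{ax^2+bx+\left(\frac{a-d}{3}\right)^3}{x^2+dx+\frac{(a-d)^2}{3}+b},\qquad x\in\mathbb{C}_p,\ x\neq x_1,x_2,$$ where $x_1,x_2\in\mathbb{C}_p$ are the zeros of the denominator. Put $x_0=\frac{a-d}{3}$, $\delta=\left|\frac{2a+d}{3}\right|_p$, $\alpha=|x_0-x_1|_p$, $\beta=|x_0-x_2|_p$, and assume $\alpha=\beta$. If $\alpha>\delta$, then the dynamical system generated by $f$ has the following properties. 1. (1.1) $SI(x_0)=U_\alpha(x_0)$; (1.2) $\mathcal{P}\subset S_\alpha(x_0)$. 2. If $r>\alpha$ and $x\in S_r(x_0)$, then for every $n\geq 1$: $f^n(x)\in S_{\alpha^2/r}(x_0)$ if $\alpha<r<\frac{\alpha^2}{\delta}$; $f^n(x)\in S_{\delta^*(x)}(x_0)$ if $r=\frac{\alpha^2}{\delta}$; $f^n(x)\in S_\delta(x_0)$ if $r>\frac{\alpha^2}{\delta}$. 3. If $x\in S_\alpha(x_0)\setminus\mathcal{P}$, then one of the following two possibilities holds: (3.1) there exist $k\in\mathbb{N}$ and $\mu_k>\alpha$ such that $f^k(x)\in S_{\mu_k}(x_0)$, for every $m\geq k+1$ one has $f^m(x)\in S_{\alpha^2/\mu_k}(x_0)$ if $\alpha<\mu_k<\frac{\alpha^2}{\delta}$, $f^m(x)\in S_{\delta^*(f^k(x))}(x_0)$ if $\mu_k=\frac{\alpha^2}{\delta}$,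 and $f^m(x)\in S_\delta(x_0)$ if $\mu_k>\frac{\alpha^2}{\delta}$, and moreover $f^m(x)\in S_\alpha(x_0)$ if $m\leq k-1$; (3.2) the trajectory $\{f^k(x): k\geq 1\}$ is a subset of $S_\alpha(x_0)$.
   Context: $p$ is a prime, $\mathbb{C}_p$ is the field of complex $p$-adic numbers with norm $|\cdot|_p$, and $\mathbb{N}=\{1,2,\dots\}$. For $c\in\mathbb{C}_p$ and $r\ge 0$: $U_r(c)=\{x\in\mathbb{C}_p:|x-c|_p<r\}$, $V_r(c)=\{x\in\mathbb{C}_p:|x-c|_p\leq r\}$, $S_r(c)=\{x\in\mathbb{C}_p:|x-c|_p=r\}$. $f^n$ denotes the $n$-fold iterate of $f$ (with $f^0$ the identity), defined at $x$ as long as no earlier iterate is $x_1$ or $x_2$. The point $x_0$ is the unique fixed point of $f$. The set of points eventually mapped to a zero of the denominator is $$\mathcal{P}=\{x\in\mathbb{C}_p:\ \exists n\in\mathbb{N}\cup\{0\},\ f^n(x)\in\{x_1,x_2\}\}.$$ A ball $U_r(x_0)$ is a Siegel disk if each sphere $S_\rho(x_0)$, $\rho<r$, is invariant for $f$, i.e. $x\in S_\rho(x_0)$ implies that $f^n(x)$ is defined and lies in $S_\rho(x_0)$ for all $n\ge1$. $SI(x_0)$ (the maximum Siegel disk) is the union of all Siegel disks centered at $x_0$. For $x\in S_{\alpha^2/\delta}(x_0)$, $\delta^*(x)=|f(x)-x_0|_p$. If $\delta=0$, then $\alpha^2/\delta$ is read as $+\infty$ (so every finite $r>\alpha$ falls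 in the case $\alpha<r<\alpha^2/\delta$). *)

theory Defs
  imports "HOL-Analysis.Analysis" "HOL-Computational_Algebra.Computational_Algebra"
begin

section \<open>The field of complex p-adic numbers\<close>

text \<open>
  The field is introduced through its defining description, which determines it up to an
  isometric isomorphism of fields: it is the completion of an algebraic closure of the p-adic
  numbers. Algebraic closedness is the type class \<open>alg_closed_field\<close>, completeness is the type
  class \<open>complete_space\<close>. The predicate \<open>complex_padic p nrm\<close> adds that the metric is induced by
  the non-archimedean absolute value \<open>nrm\<close>, that \<open>nrm\<close> extends the p-adic absolute value, and that
  the elements algebraic over the p-adic numbers are dense. The p-adic numbers are the closure of
  the rationals, which in a complete field is their completion. (The library's \<open>norm\<close> is reserved
  for real vector spaces, so the absolute value is a parameter.)
\<close>

definition padic_numbers :: "'a::{field_char_0,metric_space} set" where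
  "padic_numbers = closure \<rat>"

definition algebraic_over :: "'a::field set \<Rightarrow> 'a \<Rightarrow> bool" where
  "algebraic_over F x \<longleftrightarrow> (\<exists>q. q \<noteq> 0 \<and> (\<forall>i. coeff q i \<in> F) \<and> poly q x = 0)"

definition complex_padic ::
  "nat \<Rightarrow> ('a::{field_char_0,alg_closed_field,complete_space} \<Rightarrow> real) \<Rightarrow> bool" where
  "complex_padic p nrm \<longleftrightarrow>
     prime p \<and>
     (\<forall>x y. dist x y = nrm (x - y)) \<and>
     (\<forall>x y. nrm (x * y) = nrm x * nrm y) \<and>
     (\<forall>x y. nrm (x + y) \<le> max (nrm x) (nrm y)) \<and>
     (\<forall>n>0. nrm (of_nat n) = 1 / real p ^ multiplicity p n) \<and>
     closure {x :: 'a. algebraic_over padic_numbers x} = UNIV"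


section \<open>Iteration of partially defined maps\<close>

text \<open>
  A partial map takes the value \<open>None\<close> where it is undefined. Accordingly
  \<open>iter f n x \<in> Some ` S\<close> says that the n-th iterate is defined at x and lies in S.
\<close>

primrec iter :: "('a \<Rightarrow> 'a option) \<Rightarrow> nat \<Rightarrow> 'a \<Rightarrow> 'a option" where
  "iter f 0 x = Some x"
| "iter f (Suc n) x = Option.bind (iter f n x) f"

definition siegel_disk :: "('a::metric_space \<Rightarrow> 'a option) \<Rightarrow> 'a \<Rightarrow> real \<Rightarrow> bool" where
  "siegel_disk f c r \<longleftrightarrow>
     (\<forall>\<rho><r. \<forall>x\<in>sphere c \<rho>. \<forall>n\<ge>1. iter f n x \<in> Some ` sphere c \<rho>)"

definition max_siegel_disk :: "('a::metric_space \<Rightarrow> 'a option) \<Rightarrow> 'a \<Rightarrow> 'a set" where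
  "max_siegel_disk f c = \<Union> {ball c r | r. r \<ge> 0 \<and> siegel_disk f c r}"

definition eventually_in :: "('a \<Rightarrow> 'a option) \<Rightarrow> 'a set \<Rightarrow> 'a set" where
  "eventually_in f Z = {x. \<exists>n. iter f n x \<in> Some ` Z}"


section \<open>The rational function\<close>

definition denom :: "'a::field \<Rightarrow> 'a \<Rightarrow> 'a \<Rightarrow> 'a \<Rightarrow> 'a" where
  "denom a b d x = x^2 + d * x + (a - d)^2 / 3 + b"

definition rat_map :: "'a::field \<Rightarrow> 'a \<Rightarrow> 'a \<Rightarrow> 'a \<Rightarrow> 'a option" where
  "rat_map a b d x =
     (if denom a b d x = 0 then None
      else Some ((a * x^2 + b * x + ((a - d) / 3)^3) / denom a b d x))"

text \<open>Only meant for points at which \<open>f\<close> is defined.\<close>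
definition delta_star :: "('a::minus \<Rightarrow> real) \<Rightarrow> ('a \<Rightarrow> 'a option) \<Rightarrow> 'a \<Rightarrow> 'a \<Rightarrow> real" where
  "delta_star nrm f c x = nrm (the (f x) - c)"

text \<open>The quotient \<open>\<alpha>\<^sup>2 / \<delta>\<close>, read as infinity for \<open>\<delta> = 0\<close>
  (the real division would give 0).\<close>
definition crit_radius :: "real \<Rightarrow> real \<Rightarrow> ereal" where
  "crit_radius \<alpha> \<delta> = (if \<delta> = 0 then \<infinity> else ereal (\<alpha>^2 / \<delta>))"

end

theory Submission
  imports Defs
begin

text \<open>
  Put \<open>y = x - x\<^sub>0\<close>, \<open>u = x\<^sub>0 - x\<^sub>1\<close>, \<open>v = x\<^sub>0 - x\<^sub>2\<close>. Then \<open>u + v = (2a + d)/3\<close> and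
  \<open>f(x) - x\<^sub>0 = y ((u + v) y + u v) / (y\<^sup>2 + (u + v) y + u v)\<close>, where \<open>|u v| = \<alpha>\<^sup>2\<close> and
  \<open>|u + v| = \<delta> < \<alpha>\<close>. By the ultrametric inequality the denominator has absolute value \<open>\<alpha>\<^sup>2\<close> inside
  the ball of radius \<open>\<alpha>\<close> and \<open>|y|\<^sup>2\<close> outside it, and at most \<open>\<alpha>\<^sup>2\<close> on the sphere. Hence \<open>f\<close>
  preserves \<open>|y|\<close> inside, sends the outside into the ball, and never sends the sphere into the ball.
\<close>

section \<open>Iterates of partial maps\<close>

lemma iter_add: "iter f (m + n) x = Option.bind (iter f m x) (iter f n)"
proof (induction n)
  case 0
  show ?case by (cases "iter f m x") auto
next
  case (Suc n)
  then show ?case by (cases "iter f m x") auto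
qed

lemma iter_Suc_left: "iter f (Suc n) x = Option.bind (f x) (iter f n)"
  using iter_add[of f 1 n x] by simp

lemma iter_invariant:
  assumes "\<And>x. x \<in> S \<Longrightarrow> f x \<in> Some ` S" "x \<in> S"
  shows "iter f n x \<in> Some ` S"
proof (induction n)
  case 0
  show ?case using assms(2) by simp
next
  case (Suc n)
  then obtain y where "iter f n x = Some y" "y \<in> S" by auto
  then show ?case using assms(1)[of y] by simp
qed

text \<open>For starting points that need not lie in \<open>S\<close> themselves: one step lands in
  \<open>S\<close>, and the orbit stays there. Hence \<open>n \<ge> 1\<close>.\<close>

lemma iter_into_invariant:
  assumes "\<And>x. x \<in> S \<Longrightarrow> f x \<in> Some ` S" "f x \<in> Some ` S" "n \<ge> 1"
  shows "iter f n x \<in> Some ` S"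
proof -
  obtain m where n: "n = Suc m" using assms(3) by (cases n) auto
  obtain y where "f x = Some y" "y \<in> S" using assms(2) by auto
  then show ?thesis
    using iter_invariant[OF assms(1), where x = y and n = m] by (simp only: n iter_Suc_left) simp
qed

section \<open>Non-archimedean absolute values\<close>

locale nonarchimedean =
  fixes nrm :: "'a::{field,metric_space} \<Rightarrow> real"
  assumes dist_nrm: "dist x y = nrm (x - y)"
    and nrm_mult: "nrm (x * y) = nrm x * nrm y"
    and nrm_add_le: "nrm (x + y) \<le> max (nrm x) (nrm y)"
begin

lemma nrm_ge_0 [simp]: "nrm x \<ge> 0"
  using dist_nrm[of x 0] zero_le_dist[of x 0] by simp

lemma nrm_eq_0_iff [simp]: "nrm x = 0 \<longleftrightarrow> x = 0"
  using dist_nrm[of x 0] dist_eq_0_iff[of x 0] by simp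

lemma nrm_minus [simp]: "nrm (- x) = nrm x"
  using dist_nrm[of 0 x] dist_nrm[of x 0] dist_commute[of 0 x] by simp

lemma nrm_minus_commute: "nrm (x - y) = nrm (y - x)"
  using nrm_minus[of "x - y"] by simp

lemma nrm_divide: "y \<noteq> 0 \<Longrightarrow> nrm (x / y) = nrm x / nrm y"
  using nrm_mult[of "x / y" y] by (simp add: field_simps)

text \<open>Writing \<open>x\<close> as \<open>(x + y) + (- y)\<close>, the ultrametric inequality
  bounds \<open>nrm x\<close> by the maximum of \<open>nrm (x + y)\<close> and \<open>nrm y\<close>,
  and the second of these is too small.\<close>

lemma nrm_add_eq_left:
  assumes "nrm y < nrm x"
  shows "nrm (x + y) = nrm x"
  using nrm_add_le[of x y] nrm_add_le[of "x + y" "- y"] assms by simp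

lemma nrm_add_eq_right: "nrm x < nrm y \<Longrightarrow> nrm (x + y) = nrm y"
  using nrm_add_eq_left[of x y] by (simp add: add.commute)

lemma mem_sphere_iff: "x \<in> sphere c r \<longleftrightarrow> nrm (x - c) = r"
  by (simp add: dist_nrm nrm_minus_commute)

end

section \<open>The map in coordinates around its fixed point\<close>

text \<open>The poles are \<open>c - u\<close> and \<open>c - v\<close>. The denominator is kept as
  a product so that each linear factor can be estimated separately; \<open>u + v\<close> and
  \<open>u * v\<close> are the coefficients of its expansion in \<open>x - c\<close>.\<close>

locale centered_map = nonarchimedean nrm
  for nrm :: "'a::{field,metric_space} \<Rightarrow> real" +
  fixes f :: "'a \<Rightarrow> 'a option" and c u v :: 'a and \<alpha> \<delta> :: real
  assumes f_eq: "f x = (if (x - c + u) * (x - c + v) = 0 then None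
      else Some (c + (x - c) * ((u + v) * (x - c) + u * v) / ((x - c + u) * (x - c + v))))"
    and nrm_u: "nrm u = \<alpha>" and nrm_v: "nrm v = \<alpha>"
    and nrm_uv: "nrm (u + v) = \<delta>" and \<delta>_less: "\<delta> < \<alpha>"
begin

lemma \<delta>_ge_0: "\<delta> \<ge> 0"
  using nrm_ge_0[of "u + v"] nrm_uv by simp

lemma \<alpha>_pos: "\<alpha> > 0"
  using \<delta>_ge_0 \<delta>_less by simp

lemma f_SomeD:
  assumes "f x = Some z"
  shows "nrm (z - c) = nrm (x - c) * nrm ((u + v) * (x - c) + u * v)
           / (nrm (x - c + u) * nrm (x - c + v))"
  using assms unfolding f_eq by (auto simp: nrm_mult nrm_divide split: if_splits)

lemma f_eq_None_iff: "f x = None \<longleftrightarrow> x \<in> {c - u, c - v}"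
proof -
  have "x - c + w = 0 \<longleftrightarrow> x = c - w" for w
    unfolding eq_iff_diff_eq_0[of x "c - w"] by (simp add: algebra_simps)
  then show ?thesis unfolding f_eq by auto
qed

lemma poles_in_sphere: "{c - u, c - v} \<subseteq> sphere c \<alpha>"
  by (auto simp: dist_nrm nrm_u nrm_v)

lemma f_defined: "x \<notin> sphere c \<alpha> \<Longrightarrow> \<exists>z. f x = Some z"
  using f_eq_None_iff[of x] poles_in_sphere by (cases "f x") auto

text \<open>The constant term \<open>u * v\<close> dominates because \<delta> < \<alpha>. The
  boundary case is included, since the estimate also serves on the sphere of radius
  \<alpha>.\<close>

lemma nrm_numerator_inside:
  assumes "nrm (x - c) \<le> \<alpha>"
  shows "nrm ((u + v) * (x - c) + u * v) = \<alpha>\<^sup>2"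
proof -
  have "\<delta> * nrm (x - c) \<le> \<delta> * \<alpha>"
    using assms \<delta>_ge_0 by (rule mult_left_mono)
  also have "\<dots> < \<alpha> * \<alpha>"
    using \<delta>_less \<alpha>_pos by simp
  finally show ?thesis
    using nrm_add_eq_right[of "(u + v) * (x - c)" "u * v"]
    by (simp add: nrm_mult nrm_uv nrm_u nrm_v power2_eq_square)
qed

lemma f_inside:
  assumes "x \<in> sphere c \<rho>" "\<rho> < \<alpha>"
  shows "f x \<in> Some ` sphere c \<rho>"
proof -
  have x: "nrm (x - c) = \<rho>" using assms(1) by (simp only: mem_sphere_iff)
  obtain z where z: "f x = Some z"
    using f_defined[of x] assms by auto
  \<comment> \<open>Both linear factors are dominated by their constant terms, so the factor
    multiplying \<open>nrm (x - c)\<close> is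
    \<open>\<alpha>\<^sup>2 / \<alpha>\<^sup>2 = 1\<close>.\<close>
  have "nrm (x - c + u) = \<alpha>" "nrm (x - c + v) = \<alpha>"
    using nrm_add_eq_right[of "x - c" u] nrm_add_eq_right[of "x - c" v] x assms(2)
    by (simp_all add: nrm_u nrm_v)
  then have "nrm (z - c) = \<rho>"
    using f_SomeD[OF z] nrm_numerator_inside[of x] x assms(2) \<alpha>_pos
    by (simp add: power2_eq_square)
  then show ?thesis using z by (auto simp: mem_sphere_iff simp del: mem_sphere)
qed

lemma iter_inside:
  assumes "x \<in> sphere c \<rho>" "\<rho> < \<alpha>"
  shows "iter f n x \<in> Some ` sphere c \<rho>"
  using f_inside assms by (intro iter_invariant)

section \<open>Points outside the closed ball of radius \<alpha>\<close>

lemma nrm_f_outside: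
  assumes "nrm (x - c) > \<alpha>" "f x = Some z"
  shows "nrm (z - c) = nrm ((u + v) * (x - c) + u * v) / nrm (x - c)"
proof -
  have "nrm (x - c + u) = nrm (x - c)" "nrm (x - c + v) = nrm (x - c)"
    using assms(1) by (auto intro!: nrm_add_eq_left simp: nrm_u nrm_v)
  then show ?thesis
    using f_SomeD[OF assms(2)] assms(1) \<alpha>_pos by simp
qed

text \<open>The two terms of the numerator factor have absolute values \<open>\<delta> * r\<close>
  and \<open>\<alpha>\<^sup>2\<close>, which balance exactly at the critical radius. Away from it
  the larger one decides; at it cancellation is possible and only the bound by \<alpha> is
  asserted.\<close>

lemma f_outside:
  assumes x: "x \<in> sphere c r" and r: "r > \<alpha>"
  obtains z where "f x = Some z" "nrm (z - c) < \<alpha>"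
    "ereal r < crit_radius \<alpha> \<delta> \<longrightarrow> nrm (z - c) = \<alpha>\<^sup>2 / r"
    "ereal r > crit_radius \<alpha> \<delta> \<longrightarrow> nrm (z - c) = \<delta>"
proof -
  have nx: "nrm (x - c) = r" using x by (simp only: mem_sphere_iff)
  obtain z where z: "f x = Some z"
    using f_defined[of x] x r by auto
  have nz: "nrm (z - c) = nrm ((u + v) * (x - c) + u * v) / r"
    using nrm_f_outside[OF _ z] nx r by simp
  have gy: "nrm ((u + v) * (x - c)) = \<delta> * r" and uv: "nrm (u * v) = \<alpha>\<^sup>2"
    by (simp_all add: nrm_mult nrm_uv nrm_u nrm_v nx power2_eq_square)
  have r0: "r > 0" using r \<alpha>_pos by simp
  \<comment> \<open>Both terms stay below \<open>\<alpha> * r\<close>, so the image falls into the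
    open ball of radius \<alpha> whichever term is larger.\<close>
  have "\<delta> * r < \<alpha> * r" "\<alpha>\<^sup>2 < \<alpha> * r"
    using \<delta>_less r \<alpha>_pos r0 by (simp_all add: power2_eq_square)
  then have "nrm ((u + v) * (x - c) + u * v) < \<alpha> * r"
    using nrm_add_le[of "(u + v) * (x - c)" "u * v"] unfolding gy uv by linarith
  then have lt: "nrm (z - c) < \<alpha>"
    using nz r0 by (simp add: pos_divide_less_eq)
  have small: "nrm (z - c) = \<alpha>\<^sup>2 / r" if "ereal r < crit_radius \<alpha> \<delta>"
  proof -
    \<comment> \<open>If \<delta> = 0, the critical radius is infinite and this reads
      \<open>0 < \<alpha>\<^sup>2\<close>.\<close>
    have "\<delta> * r < \<alpha>\<^sup>2"
      using that \<delta>_ge_0 \<alpha>_pos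
      by (auto simp: crit_radius_def field_simps split: if_splits)
    then have "nrm ((u + v) * (x - c) + u * v) = \<alpha>\<^sup>2"
      using nrm_add_eq_right[of "(u + v) * (x - c)" "u * v"] by (simp add: gy uv)
    then show ?thesis using nz by simp
  qed
  have large: "nrm (z - c) = \<delta>" if "ereal r > crit_radius \<alpha> \<delta>"
  proof -
    have "\<delta> * r > \<alpha>\<^sup>2"
      using that \<delta>_ge_0
      by (auto simp: crit_radius_def field_simps split: if_splits)
    then have "nrm ((u + v) * (x - c) + u * v) = \<delta> * r"
      using nrm_add_eq_left[of "u * v" "(u + v) * (x - c)"] by (simp add: gy uv)
    then show ?thesis using nz r0 by simp
  qed
  show ?thesis using that z lt small large by blast
qed

text \<open>After one step the point is on a sphere of radius less than \<alpha>, which is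
  invariant. Its radius is \<open>delta_star\<close> in all three regimes, so one argument covers
  them.\<close>

lemma iter_outside:
  assumes "x \<in> sphere c r" "r > \<alpha>" "n \<ge> 1"
  shows "iter f n x \<in> Some ` sphere c (delta_star nrm f c x)"
    and "delta_star nrm f c x < \<alpha>"
    and "ereal r < crit_radius \<alpha> \<delta> \<longrightarrow> delta_star nrm f c x = \<alpha>\<^sup>2 / r"
    and "ereal r > crit_radius \<alpha> \<delta> \<longrightarrow> delta_star nrm f c x = \<delta>"
proof -
  obtain z where z: "f x = Some z" "nrm (z - c) < \<alpha>"
    "ereal r < crit_radius \<alpha> \<delta> \<longrightarrow> nrm (z - c) = \<alpha>\<^sup>2 / r"
    "ereal r > crit_radius \<alpha> \<delta> \<longrightarrow> nrm (z - c) = \<delta>"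
    using f_outside[OF assms(1,2)] by blast
  have ds: "delta_star nrm f c x = nrm (z - c)"
    by (simp add: delta_star_def z(1))
  show "delta_star nrm f c x < \<alpha>"
    "ereal r < crit_radius \<alpha> \<delta> \<longrightarrow> delta_star nrm f c x = \<alpha>\<^sup>2 / r"
    "ereal r > crit_radius \<alpha> \<delta> \<longrightarrow> delta_star nrm f c x = \<delta>"
    unfolding ds using z by auto
  show "iter f n x \<in> Some ` sphere c (delta_star nrm f c x)"
  proof (rule iter_into_invariant[OF _ _ assms(3)])
    show "f x \<in> Some ` sphere c (delta_star nrm f c x)"
      by (auto simp: z(1) ds mem_sphere_iff simp del: mem_sphere)
    show "f y \<in> Some ` sphere c (delta_star nrm f c x)"
      if "y \<in> sphere c (delta_star nrm f c x)" for y
      using f_inside[OF that] ds z(2) by (simp only:)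
  qed
qed

text \<open>The form used both for orbits that start outside and for orbits that leave the sphere of
  radius \<alpha> later.\<close>

lemma iter_outside_cases:
  assumes "x \<in> sphere c r" "r > \<alpha>" "n \<ge> 1"
  shows "(ereal r < crit_radius \<alpha> \<delta> \<longrightarrow> iter f n x \<in> Some ` sphere c (\<alpha>\<^sup>2 / r))
       \<and> (ereal r = crit_radius \<alpha> \<delta> \<longrightarrow> iter f n x \<in> Some ` sphere c (delta_star nrm f c x))
       \<and> (ereal r > crit_radius \<alpha> \<delta> \<longrightarrow> iter f n x \<in> Some ` sphere c \<delta>)"
  using iter_outside[OF assms] by auto

section \<open>The sphere of radius \<alpha>, the maximal Siegel disk and the preimages of the
  poles\<close>

text \<open>The numerator still has absolute value \<open>\<alpha> * \<alpha>\<^sup>2\<close>, while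
  each linear factor of the denominator is now only bounded above by \<alpha>.\<close>

lemma f_on_sphere:
  assumes "x \<in> sphere c \<alpha>" "f x = Some z"
  shows "nrm (z - c) \<ge> \<alpha>"
proof -
  let ?D = "nrm (x - c + u) * nrm (x - c + v)"
  have nx: "nrm (x - c) = \<alpha>" using assms(1) by (simp only: mem_sphere_iff)
  have "nrm (x - c + u) \<le> \<alpha>" "nrm (x - c + v) \<le> \<alpha>"
    using nrm_add_le[of "x - c" u] nrm_add_le[of "x - c" v] nx by (simp_all add: nrm_u nrm_v)
  then have D: "?D \<le> \<alpha>\<^sup>2"
    unfolding power2_eq_square using \<alpha>_pos by (intro mult_mono) auto
  have "?D > 0"
    using assms(2) unfolding f_eq
    by (auto simp: less_le split: if_splits)
  then have "\<alpha> \<le> \<alpha> * \<alpha>\<^sup>2 / ?D"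
    using D \<alpha>_pos by (simp add: field_simps)
  then show ?thesis
    using f_SomeD[OF assms(2)] nrm_numerator_inside[of x] nx by simp
qed

lemma max_siegel_disk_eq: "max_siegel_disk f c = ball c \<alpha>"
proof (intro equalityI subsetI)
  fix x assume "x \<in> max_siegel_disk f c"
  then obtain r where r: "siegel_disk f c r" "x \<in> ball c r"
    unfolding max_siegel_disk_def by blast
  have pole: "c - u \<in> sphere c \<alpha>" "f (c - u) = None"
    using poles_in_sphere f_eq_None_iff[of "c - u"] by auto
  have "r \<le> \<alpha>"
  proof (rule ccontr)
    assume "\<not> r \<le> \<alpha>"
    \<comment> \<open>A larger Siegel disk would make the sphere of radius \<alpha> invariant, but
      that sphere contains a pole.\<close>
    then have "iter f 1 (c - u) \<in> Some ` sphere c \<alpha>"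
      using r(1) pole(1) unfolding siegel_disk_def by (meson not_le order_refl)
    then show False using pole(2) by auto
  qed
  then show "x \<in> ball c \<alpha>" using r(2) by simp
next
  fix x assume "x \<in> ball c \<alpha>"
  moreover have "siegel_disk f c \<alpha>"
    unfolding siegel_disk_def using iter_inside by blast
  ultimately show "x \<in> max_siegel_disk f c"
    unfolding max_siegel_disk_def using \<alpha>_pos by (blast intro: less_imp_le)
qed

text \<open>An orbit starting off the sphere either keeps its distance to \<open>c\<close> or drops
  into the open ball after one step; in neither case does it meet the sphere, where the poles
  lie.\<close>

lemma eventually_pole_in_sphere: "eventually_in f {c - u, c - v} \<subseteq> sphere c \<alpha>"
proof
  fix x assume "x \<in> eventually_in f {c - u, c - v}"
  then obtain n w where n: "iter f n x = Some w" "w \<in> {c - u, c - v}"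
    unfolding eventually_in_def by auto
  have w: "w \<in> sphere c \<alpha>" using n(2) poles_in_sphere by auto
  define r where "r = dist c x"
  have xr: "x \<in> sphere c r" by (simp add: r_def)
  consider "r < \<alpha>" | "r = \<alpha>" | "r > \<alpha>" by linarith
  then show "x \<in> sphere c \<alpha>"
  proof cases
    case 1
    then show ?thesis using iter_inside[OF xr, of n] n(1) w by auto
  next
    case 2
    then show ?thesis using xr by simp
  next
    case 3
    show ?thesis
    proof (cases n)
      case 0
      then show ?thesis using n(1) w by simp
    next
      case (Suc m)
      then show ?thesis using iter_outside(1,2)[OF xr 3, of n] n(1) w by auto
    qed
  qed
qed

text \<open>An orbit that avoids the poles can leave the sphere only outwards, by
  \<open>f_on_sphere\<close>; \<open>k\<close> is its first exit time.\<close>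

lemma sphere_cases:
  assumes "x \<in> sphere c \<alpha>" "x \<notin> eventually_in f {c - u, c - v}"
  obtains (stay) "\<And>n. iter f n x \<in> Some ` sphere c \<alpha>"
  | (leave) k \<mu> y where "k \<ge> 1" "\<mu> > \<alpha>" "iter f k x = Some y" "y \<in> sphere c \<mu>"
      "\<And>m. m < k \<Longrightarrow> iter f m x \<in> Some ` sphere c \<alpha>"
proof (cases "\<forall>n. iter f n x \<in> Some ` sphere c \<alpha>")
  case True
  then show ?thesis using stay by blast
next
  case False
  \<comment> \<open>At time \<open>k\<close> the iterate could a priori be undefined; this is
    excluded below because the preceding point \<open>w\<close> is not a pole.\<close>
  define k where "k = (LEAST n. iter f n x \<notin> Some ` sphere c \<alpha>)"
  have k: "iter f k x \<notin> Some ` sphere c \<alpha>"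
    using False LeastI_ex[of "\<lambda>n. iter f n x \<notin> Some ` sphere c \<alpha>"] unfolding k_def by blast
  have before: "iter f m x \<in> Some ` sphere c \<alpha>" if "m < k" for m
    using that not_less_Least unfolding k_def by blast
  obtain j where j: "k = Suc j"
    using k assms(1) by (cases k) auto
  obtain w where w: "iter f j x = Some w" "w \<in> sphere c \<alpha>"
    using before[of j] j by auto
  have "w \<notin> {c - u, c - v}"
    using assms(2) w(1) unfolding eventually_in_def by force
  then obtain y where y: "f w = Some y"
    using f_eq_None_iff[of w] by auto
  have ky: "iter f k x = Some y" using j w(1) y by simp
  have "nrm (y - c) \<ge> \<alpha>" using f_on_sphere[OF w(2) y] .
  moreover have "nrm (y - c) \<noteq> \<alpha>"
    using k ky mem_sphere_iff[of y c \<alpha>] by auto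
  ultimately show ?thesis
    using leave[of k "nrm (y - c)" y] j ky before by (simp add: mem_sphere_iff del: mem_sphere)
qed

end

section \<open>From the coefficients to the centered form\<close>

text \<open>
  The denominator is invariant under \<open>x \<mapsto> - d - x\<close>, so \<open>x\<^sub>1 = x\<^sub>2\<close> can only occur for a double zero.
\<close>
lemma denom_factor:
  fixes a b d :: "'a::field"
  assumes "{x. denom a b d x = 0} = {x\<^sub>1, x\<^sub>2}"
  shows "denom a b d x = (x - x\<^sub>1) * (x - x\<^sub>2)" and "x\<^sub>1 + x\<^sub>2 = - d"
proof -
  have z1: "denom a b d x\<^sub>1 = 0" and z2: "denom a b d x\<^sub>2 = 0"
    using assms by auto
  have "denom a b d (- d - x\<^sub>1) = denom a b d x\<^sub>1"
    by (simp add: denom_def power2_eq_square algebra_simps)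
  then have mem: "- d - x\<^sub>1 \<in> {x\<^sub>1, x\<^sub>2}"
    unfolding assms[symmetric] using z1 by (simp only: mem_Collect_eq)
  show sum: "x\<^sub>1 + x\<^sub>2 = - d"
  proof (cases "x\<^sub>1 = x\<^sub>2")
    case True
    then have "- d - x\<^sub>1 = x\<^sub>2" using mem by blast
    then have "- d = x\<^sub>2 + x\<^sub>1" by (simp only: diff_eq_eq)
    then show ?thesis by (simp only: add.commute)
  next
    case False
    \<comment> \<open>For distinct zeros the first factor can be cancelled.\<close>
    have "(x\<^sub>1 - x\<^sub>2) * (x\<^sub>1 + x\<^sub>2 + d) = denom a b d x\<^sub>1 - denom a b d x\<^sub>2"
      by (simp add: denom_def power2_eq_square algebra_simps)
    then have "x\<^sub>1 + x\<^sub>2 + d = 0" using z1 z2 False by simp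
    then show ?thesis by (simp add: eq_neg_iff_add_eq_0)
  qed
  have "denom a b d x = denom a b d x - denom a b d x\<^sub>1" using z1 by simp
  also have "\<dots> = (x - x\<^sub>1) * (x + x\<^sub>1 + d)"
    by (simp add: denom_def power2_eq_square algebra_simps)
  also have "x + x\<^sub>1 + d = x - x\<^sub>2" using sum by (simp add: eq_neg_iff_add_eq_0 algebra_simps)
  finally show "denom a b d x = (x - x\<^sub>1) * (x - x\<^sub>2)" .
qed

text \<open>Subtracting \<open>c\<close> times the denominator from the numerator leaves a multiple
  of \<open>x - c\<close>; the special constant terms of numerator and denominator make this
  work.\<close>

lemma rat_map_centered:
  fixes a b d :: "'a::field_char_0"
  assumes zeros: "{x. denom a b d x = 0} = {x\<^sub>1, x\<^sub>2}" and c: "c = (a - d) / 3"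
    and u: "u = c - x\<^sub>1" and v: "v = c - x\<^sub>2"
  shows "u + v = (2 * a + d) / 3"
    and "rat_map a b d x = (if (x - c + u) * (x - c + v) = 0 then None
      else Some (c + (x - c) * ((u + v) * (x - c) + u * v) / ((x - c + u) * (x - c + v))))"
proof -
  \<comment> \<open>Eliminating \<open>a\<close> removes the divisions by 3:
    \<open>(a - d)^2 / 3\<close> becomes \<open>3 * c^2\<close>.\<close>
  have ad: "a = d + 3 * c" using c by (simp add: field_simps)
  have "u + v = 2 * c - (x\<^sub>1 + x\<^sub>2)" by (simp add: u v)
  then have uv: "u + v = 2 * c + d" using denom_factor(2)[OF zeros] by simp
  show "u + v = (2 * a + d) / 3" unfolding uv ad by simp
  have D: "denom a b d y = (y - c + u) * (y - c + v)" for y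
    by (simp add: denom_factor(1)[OF zeros] u v)
  have *: "a * x\<^sup>2 + b * x + ((a - d) / 3) ^ 3
      = c * denom a b d x + (x - c) * ((u + v) * (x - c) + u * v)"
  proof -
    \<comment> \<open>Evaluating the factored denominator at \<open>c\<close> expresses
      \<open>u * v\<close> through the coefficients.\<close>
    have "u * v = denom a b d c" by (simp add: D)
    also have "denom a b d c = 4 * c\<^sup>2 + d * c + b"
      unfolding denom_def ad by (simp add: power2_eq_square)
    finally have prod: "u * v = 4 * c\<^sup>2 + d * c + b" .
    have "denom a b d x = x\<^sup>2 + d * x + 3 * c\<^sup>2 + b"
      unfolding denom_def ad by (simp add: power2_eq_square)
    then show ?thesis
      unfolding uv prod c[symmetric]
      by (simp add: ad power2_eq_square power3_eq_cube algebra_simps)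
  qed
  show "rat_map a b d x = (if (x - c + u) * (x - c + v) = 0 then None
      else Some (c + (x - c) * ((u + v) * (x - c) + u * v) / ((x - c + u) * (x - c + v))))"
    unfolding rat_map_def * by (simp add: D add_divide_distrib)
qed

section \<open>Transfer of the centered results to the rational map\<close>

theorem theorem1:
  fixes p :: nat
    and nrm :: "'a::{field_char_0,alg_closed_field,complete_space} \<Rightarrow> real"
    and a b d x\<^sub>0 x\<^sub>1 x\<^sub>2 :: 'a
    and f :: "'a \<Rightarrow> 'a option"
    and \<alpha> \<beta> \<delta> :: real
    and \<P> :: "'a set"
  assumes Cp: "complex_padic p nrm"
    and "a \<noteq> 0"
    and "b \<noteq> - 2 * a^2 \<or> d \<noteq> - 2 * a"
    and f: "f = rat_map a b d"
    and zeros: "{x. denom a b d x = 0} = {x\<^sub>1, x\<^sub>2}"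
    and x0: "x\<^sub>0 = (a - d) / 3"
    and \<delta>: "\<delta> = nrm ((2 * a + d) / 3)"
    and \<alpha>: "\<alpha> = nrm (x\<^sub>0 - x\<^sub>1)"
    and \<beta>: "\<beta> = nrm (x\<^sub>0 - x\<^sub>2)"
    and \<P>: "\<P> = eventually_in f {x\<^sub>1, x\<^sub>2}"
    and "\<alpha> = \<beta>"
    and "\<alpha> > \<delta>"
  shows "max_siegel_disk f x\<^sub>0 = ball x\<^sub>0 \<alpha>
    \<and> \<P> \<subseteq> sphere x\<^sub>0 \<alpha>
    \<and> (\<forall>r>\<alpha>. \<forall>x\<in>sphere x\<^sub>0 r. \<forall>n\<ge>1.
         (ereal r < crit_radius \<alpha> \<delta> \<longrightarrow> iter f n x \<in> Some ` sphere x\<^sub>0 (\<alpha>^2 / r))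
         \<and> (ereal r = crit_radius \<alpha> \<delta> \<longrightarrow> iter f n x \<in> Some ` sphere x\<^sub>0 (delta_star nrm f x\<^sub>0 x))
         \<and> (ereal r > crit_radius \<alpha> \<delta> \<longrightarrow> iter f n x \<in> Some ` sphere x\<^sub>0 \<delta>))
    \<and> (\<forall>x \<in> sphere x\<^sub>0 \<alpha> - \<P>.
         (\<exists>k\<ge>1. \<exists>\<mu>>\<alpha>. \<exists>y. iter f k x = Some y \<and> y \<in> sphere x\<^sub>0 \<mu>
            \<and> (\<forall>m\<ge>k + 1.
                 (ereal \<mu> < crit_radius \<alpha> \<delta> \<longrightarrow> iter f m x \<in> Some ` sphere x\<^sub>0 (\<alpha>^2 / \<mu>))
                 \<and> (ereal \<mu> = crit_radius \<alpha> \<delta> \<longrightarrow> iter f m x \<in> Some ` sphere x\<^sub>0 (delta_star nrm f x\<^sub>0 y))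
                 \<and> (ereal \<mu> > crit_radius \<alpha> \<delta> \<longrightarrow> iter f m x \<in> Some ` sphere x\<^sub>0 \<delta>))
            \<and> (\<forall>m\<le>k - 1. iter f m x \<in> Some ` sphere x\<^sub>0 \<alpha>))
         \<or> {iter f k x | k. k \<ge> 1} \<subseteq> Some ` sphere x\<^sub>0 \<alpha>)"
proof -
  define u v where "u = x\<^sub>0 - x\<^sub>1" and "v = x\<^sub>0 - x\<^sub>2"
  note centered = rat_map_centered[OF zeros x0 u_def v_def]
  interpret centered_map nrm f x\<^sub>0 u v \<alpha> \<delta>
  proof
    show "dist x y = nrm (x - y)" "nrm (x * y) = nrm x * nrm y"
      "nrm (x + y) \<le> max (nrm x) (nrm y)" for x y
      using Cp unfolding complex_padic_def by blast+
    show "f x = (if (x - x\<^sub>0 + u) * (x - x\<^sub>0 + v) = 0 then None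
      else Some (x\<^sub>0 + (x - x\<^sub>0) * ((u + v) * (x - x\<^sub>0) + u * v)
        / ((x - x\<^sub>0 + u) * (x - x\<^sub>0 + v))))" for x
      unfolding f by (rule centered(2))
    show "nrm u = \<alpha>" "nrm v = \<alpha>"
      using \<alpha> \<beta> \<open>\<alpha> = \<beta>\<close> by (simp_all add: u_def v_def)
    show "nrm (u + v) = \<delta>" unfolding centered(1) \<delta> ..
  qed (fact \<open>\<alpha> > \<delta>\<close>)
  have poles: "\<P> = eventually_in f {x\<^sub>0 - u, x\<^sub>0 - v}"
    by (simp add: \<P> u_def v_def)
  have part3: "(\<exists>k\<ge>1. \<exists>\<mu>>\<alpha>. \<exists>y. iter f k x = Some y \<and> y \<in> sphere x\<^sub>0 \<mu>
            \<and> (\<forall>m\<ge>k + 1.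
                 (ereal \<mu> < crit_radius \<alpha> \<delta> \<longrightarrow> iter f m x \<in> Some ` sphere x\<^sub>0 (\<alpha>^2 / \<mu>))
                 \<and> (ereal \<mu> = crit_radius \<alpha> \<delta> \<longrightarrow> iter f m x \<in> Some ` sphere x\<^sub>0 (delta_star nrm f x\<^sub>0 y))
                 \<and> (ereal \<mu> > crit_radius \<alpha> \<delta> \<longrightarrow> iter f m x \<in> Some ` sphere x\<^sub>0 \<delta>))
            \<and> (\<forall>m\<le>k - 1. iter f m x \<in> Some ` sphere x\<^sub>0 \<alpha>))
         \<or> {iter f k x | k. k \<ge> 1} \<subseteq> Some ` sphere x\<^sub>0 \<alpha>"
    (is "(\<exists>k\<ge>1. \<exists>\<mu>>\<alpha>. \<exists>y. _ \<and> _ \<and> (\<forall>m\<ge>k + 1. ?C \<mu> y m) \<and> ?S k) \<or> ?stay")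
    if "x \<in> sphere x\<^sub>0 \<alpha> - \<P>" for x
  proof -
    have x: "x \<in> sphere x\<^sub>0 \<alpha>" "x \<notin> eventually_in f {x\<^sub>0 - u, x\<^sub>0 - v}"
      using that poles by auto
    from x show ?thesis
    proof (cases rule: sphere_cases)
      case stay
      then show ?thesis by blast
    next
      case (leave k \<mu> y)
      have "?C \<mu> y m" if "m \<ge> k + 1" for m
      proof -
        \<comment> \<open>Time is counted anew from the exit point \<open>y\<close>;
          \<open>m \<ge> k + 1\<close> becomes \<open>n \<ge> 1\<close>.\<close>
        define n where "n = m - k"
        have n: "m = k + n" "n \<ge> 1" using that by (simp_all add: n_def)
        have "iter f m x = iter f n y" by (simp add: n(1) iter_add leave(3))
        then show ?thesis using iter_outside_cases[OF leave(4,2) n(2)] by simp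
      qed
      \<comment> \<open>Since \<open>k \<ge> 1\<close>, the truncated subtraction is harmless and
        \<open>m \<le> k - 1\<close> means \<open>m < k\<close>.\<close>
      moreover have "?S k" using leave(1,5) by simp
      ultimately show ?thesis using leave(1-4) by blast
    qed
  qed
  show ?thesis
    unfolding poles
    using max_siegel_disk_eq eventually_pole_in_sphere iter_outside_cases part3[unfolded poles]
    by (intro conjI ballI allI impI) blast+
qed

end
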